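(* Let $L',L'':\mathbb{Z}^2\to\mathbb{Z}^2$ be defined by $L'(x,y)=(-x+2y+1,\,y)$ and $L''(x,y)=(x,\,2x-y+1)$. For $(a,b)\in\mathbb{Z}^2$ let $\mathscr{P}_L(a,b)$ be the set of all points obtained from $(a,b)$ by applying finitely many (possibly zero) operators from $\{L',L''\}$ in any order. Then the sets $\mathscr{P}_L(a,b)$ form a partition of $\mathbb{Z}^2$, and moreover: (1) each set $\mathscr{P}_L(a,b)$ contains a point $(m,m)$ with the property that $m\le\min\{x,y\}$ for every $(x,y)\in\mathscr{P}_L(a,b)$; (2) every point of $\mathscr{P}_L(0,0)$ other than the origin is of the form $(T_k,T_{k+1})$ or $(T_{k+1},T_k)$ for some integer $k\ge0$, where $T_k=k(k+1)/2$ is the $k$-th triangular number; (3) all points of $\mathscr{P}_L(0,0)$ lie on the parabola $x+y=(x-y)^2$; (4) every set $\mathscr{P}_L(a,b)$ is a translate of $\mathscr{P}_L(0,0)$ by a vector of the form $(h,h)$, $h\in\mathbb{Z}$; (5) the lattice point $(a,b)$ belongs to the set $\mathscr{P}_L(m,m)$ (the parabola with vertex $(m,m)$), where $m=\frac12\big(a+b-(a-b)^2\big)$. *)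

theory Defs
  imports Complex_Main "HOL-Library.Disjoint_Sets" "HOL-Library.Nat_Bijection"
begin

definition L1 :: "int \<times> int \<Rightarrow> int \<times> int" where
  "L1 = (\<lambda>(x, y). (- x + 2 * y + 1, y))"

definition L2 :: "int \<times> int \<Rightarrow> int \<times> int" where
  "L2 = (\<lambda>(x, y). (x, 2 * x - y + 1))"

inductive_set PL :: "int \<Rightarrow> int \<Rightarrow> (int \<times> int) set" for a b :: int where
  start: "(a, b) \<in> PL a b"
| step1: "p \<in> PL a b \<Longrightarrow> L1 p \<in> PL a b"
| step2: "p \<in> PL a b \<Longrightarrow> L2 p \<in> PL a b"

text \<open>The triangular numbers \<open>T\<^sub>k = k(k+1)/2\<close> are \<open>triangle k\<close> from
  \<open>HOL-Library.Nat_Bijection\<close>; they are embedded into the integers with \<open>int\<close>.\<close>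

end

theory Submission imports Defs begin

text \<open>Both maps preserve \<open>x + y - (x - y)\<^sup>2\<close>, which is an even number \<open>2m\<close>, and act on the difference
  \<open>d = x - y\<close> by \<open>d \<mapsto> 1 - d\<close> and \<open>d \<mapsto> - 1 - d\<close>. These two reflections act transitively on the
  integers, so the orbits are precisely the lattice parabolas \<open>x + y - (x - y)\<^sup>2 = 2m\<close>,
  each parametrised by \<open>d\<close>.\<close>

text \<open>The coordinates solve the linear system \<open>x - y = d\<close>,
  \<open>x + y = 2 * m + d\<^sup>2\<close>. Both divisions are exact, since a product of consecutive
  integers is even.\<close>

definition parabola_point :: "int \<Rightarrow> int \<Rightarrow> int \<times> int" where
  "parabola_point m d = (m + d * (d + 1) div 2, m + d * (d - 1) div 2)"

definition vertex :: "int \<Rightarrow> int \<Rightarrow> int" where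
  "vertex a b = (a + b - (a - b)\<^sup>2) div 2"

lemma two_vertex: "2 * vertex a b = a + b - (a - b)\<^sup>2"
proof -
  have "even (a + b - (a - b)\<^sup>2)"
    by simp
  then show ?thesis
    unfolding vertex_def by simp
qed

text \<open>A point is determined by its difference and sum, and the two halved products differ by
  \<open>d\<close> and add up to \<open>d\<^sup>2\<close>. With this, \<open>div\<close> drops out
  of the computations with \<open>L1\<close> and \<open>L2\<close>.\<close>

lemma parabola_point_eq_iff:
  "(x, y) = parabola_point m d \<longleftrightarrow> x - y = d \<and> x + y - (x - y)\<^sup>2 = 2 * m"
proof -
  have even: "even (d * (d + 1))" "even (d * (d - 1))"
    by simp_all
  then obtain u v where u: "d * (d + 1) = 2 * u" and v: "d * (d - 1) = 2 * v"
    by (elim dvdE)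
  have "d * (d + 1) - d * (d - 1) = 2 * d" "d * (d + 1) + d * (d - 1) = 2 * d\<^sup>2"
    by (simp_all add: algebra_simps power2_eq_square)
  then have "u - v = d" "u + v = d\<^sup>2"
    unfolding u v by simp_all
  then show ?thesis
    unfolding parabola_point_def u v by auto
qed

lemma parabola_point_vertex: "parabola_point (vertex a b) (a - b) = (a, b)"
  using parabola_point_eq_iff[of a b "vertex a b" "a - b"] two_vertex[of a b] by simp

lemma parabola_point_zero [simp]: "parabola_point m 0 = (m, m)"
  by (simp add: parabola_point_def)

lemma vertex_diagonal [simp]: "vertex m m = m"
  by (simp add: vertex_def)

lemma L1_parabola_point: "L1 (parabola_point m d) = parabola_point m (1 - d)"
proof -
  obtain x y where xy: "(x, y) = parabola_point m d"
    by (metis surj_pair)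
  then have "x - y = d" "x + y - (x - y)\<^sup>2 = 2 * m"
    unfolding parabola_point_eq_iff by blast+
  then have "(- x + 2 * y + 1, y) = parabola_point m (1 - d)"
    unfolding parabola_point_eq_iff by (auto simp: algebra_simps power2_eq_square)
  then show ?thesis
    unfolding xy[symmetric] by (simp add: L1_def)
qed

lemma L2_parabola_point: "L2 (parabola_point m d) = parabola_point m (- 1 - d)"
proof -
  obtain x y where xy: "(x, y) = parabola_point m d"
    by (metis surj_pair)
  then have "x - y = d" "x + y - (x - y)\<^sup>2 = 2 * m"
    unfolding parabola_point_eq_iff by blast+
  then have "(x, 2 * x - y + 1) = parabola_point m (- 1 - d)"
    unfolding parabola_point_eq_iff by (auto simp: algebra_simps power2_eq_square)
  then show ?thesis
    unfolding xy[symmetric] by (simp add: L2_def)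
qed

lemma PL_reflect1:
  "parabola_point m d \<in> PL a b \<Longrightarrow> parabola_point m (1 - d) \<in> PL a b"
  using PL.step1 L1_parabola_point by metis

lemma PL_reflect2:
  "parabola_point m d \<in> PL a b \<Longrightarrow> parabola_point m (- 1 - d) \<in> PL a b"
  using PL.step2 L2_parabola_point by metis

text \<open>Composing the two reflections of the parameter gives a translation:
  \<open>1 - (- 1 - d) = d + 2\<close>, and in the other order
  \<open>- 1 - (1 - d) = d - 2\<close>.\<close>

lemma PL_shift_even:
  assumes "parabola_point m d \<in> PL a b"
  shows "parabola_point m (d + 2 * k) \<in> PL a b"
proof (induction k rule: int_induct[where k = 0])
  case base
  then show ?case using assms by simp
next
  case (step1 i)
  then show ?case
    using PL_reflect1[OF PL_reflect2[OF step1(2)]] by (simp add: algebra_simps)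
next
  case (step2 i)
  then show ?case
    using PL_reflect2[OF PL_reflect1[OF step2(2)]] by (simp add: algebra_simps)
qed

lemma PL_transitive:
  assumes "parabola_point m d \<in> PL a b"
  shows "parabola_point m e \<in> PL a b"
proof (cases "even (e - d)")
  case True
  then obtain k where "e - d = 2 * k" ..
  then have "e = d + 2 * k"
    by simp
  then show ?thesis
    using PL_shift_even[OF assms] by simp
next
  case False
  \<comment> \<open>A single reflection \<open>d \<mapsto> 1 - d\<close> switches the parity of the
    parameter; even shifts then reach \<open>e\<close>.\<close>
  then have "even (e - (1 - d))"
    by simp
  then obtain k where "e - (1 - d) = 2 * k" ..
  then have "e = 1 - d + 2 * k"
    by simp
  then show ?thesis
    using PL_shift_even[OF PL_reflect1[OF assms]] by simp
qed

lemma PL_eq_range: "PL a b = range (parabola_point (vertex a b))"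
proof
  have "p \<in> range (parabola_point (vertex a b))" if "p \<in> PL a b" for p
    using that
  proof induction
    case start
    then show ?case
      using parabola_point_vertex by (metis rangeI)
  qed (auto simp: L1_parabola_point L2_parabola_point)
  then show "PL a b \<subseteq> range (parabola_point (vertex a b))" ..
  have "parabola_point (vertex a b) (a - b) \<in> PL a b"
    by (simp add: parabola_point_vertex PL.start)
  then show "range (parabola_point (vertex a b)) \<subseteq> PL a b"
    using PL_transitive by blast
qed

text \<open>The orbits are thus the fibres of \<open>vertex\<close>, which makes the partition
  property immediate.\<close>

lemma mem_PL_iff: "(x, y) \<in> PL a b \<longleftrightarrow> vertex x y = vertex a b"
proof -
  \<comment> \<open>The existential over the parameter is settled by
    \<open>d = x - y\<close>.\<close>
  have "(x, y) \<in> PL a b \<longleftrightarrow> x + y - (x - y)\<^sup>2 = 2 * vertex a b"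
    unfolding PL_eq_range image_iff parabola_point_eq_iff by blast
  then show ?thesis
    unfolding two_vertex[symmetric] by simp
qed

lemma partition_on_PL: "partition_on UNIV {PL a b | a b. True}"
proof (rule partition_onI)
  fix p q
  assume "p \<in> {PL a b | a b. True}" "q \<in> {PL a b | a b. True}" "p \<noteq> q"
  then show "disjnt p q"
    by (auto simp: disjnt_def set_eq_iff mem_PL_iff)
next
  show "{} \<notin> {PL a b | a b. True}"
    using PL.start by blast
qed (use PL.start in auto)

text \<open>Integrality matters: the product is negative only strictly between -1 and 0.\<close>

lemma consecutive_product_nonneg: "0 \<le> d * (d + 1)" for d :: int
  by (cases "0 \<le> d") (auto simp: mult_nonpos_nonpos)

lemma vertex_le:
  assumes "(x, y) \<in> PL a b"
  shows "vertex a b \<le> min x y"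
proof -
  obtain d where "(x, y) = parabola_point (vertex a b) d"
    using assms unfolding PL_eq_range by blast
  then show ?thesis
    \<comment> \<open>The instance \<open>d\<close> bounds the first coordinate, the instance
      \<open>d - 1\<close> the second.\<close>
    using consecutive_product_nonneg[of d] consecutive_product_nonneg[of "d - 1"]
    by (simp add: parabola_point_def mult.commute)
qed

lemma int_triangle: "int (triangle k) = int k * (int k + 1) div 2"
  by (simp add: triangle_def zdiv_int algebra_simps)

text \<open>The parameter \<open>d = 0\<close> is the origin. For \<open>d = k + 1\<close> the
  halved products are the triangular numbers with indices \<open>k + 1\<close> and \<open>k\<close>;
  for \<open>d = - k - 1\<close> they trade places.\<close>

lemma PL_origin_triangle:
  assumes "p \<in> PL 0 0" "p \<noteq> (0, 0)"
  shows "\<exists>k. p = (int (triangle k), int (triangle (k + 1))) \<or>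
             p = (int (triangle (k + 1)), int (triangle k))"
proof -
  obtain d where p: "p = parabola_point 0 d"
    using assms(1) unfolding PL_eq_range by auto
  with assms(2) consider "d > 0" | "d < 0"
    by fastforce
  then show ?thesis
  proof cases
    case 1
    then have "d = int (nat (d - 1)) + 1"
      by simp
    then obtain k where d: "d = int k + 1" ..
    then have "p = (int (triangle (k + 1)), int (triangle k))"
      unfolding p d parabola_point_def int_triangle by (simp add: algebra_simps)
    then show ?thesis by blast
  next
    case 2
    then have "d = - int (nat (- d - 1)) - 1"
      by simp
    then obtain k where d: "d = - int k - 1" ..
    then have "p = (int (triangle k), int (triangle (k + 1)))"
      unfolding p d parabola_point_def int_triangle by (simp add: algebra_simps)
    then show ?thesis by blast
  qed
qed

text \<open>In \<open>parabola_point m d\<close> the vertex parameter enters only as a summand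
  \<open>m\<close> in both coordinates, and the origin has vertex 0.\<close>

lemma PL_translate: "PL a b = (\<lambda>(x, y). (x + vertex a b, y + vertex a b)) ` PL 0 0"
  unfolding PL_eq_range image_image by (simp add: parabola_point_def add.commute)

theorem theorem1p2:
  "partition_on (UNIV :: (int \<times> int) set) {PL a b | a b. True}
   \<and> (\<forall>a b. \<exists>m. (m, m) \<in> PL a b \<and> (\<forall>(x, y) \<in> PL a b. m \<le> min x y))
   \<and> (\<forall>p \<in> PL 0 0. p \<noteq> (0, 0) \<longrightarrow>
        (\<exists>k::nat. p = (int (triangle k), int (triangle (k + 1))) \<or>
                  p = (int (triangle (k + 1)), int (triangle k))))
   \<and> (\<forall>(x, y) \<in> PL 0 0. x + y = (x - y)\<^sup>2)
   \<and> (\<forall>a b. \<exists>h::int. PL a b = (\<lambda>(x, y). (x + h, y + h)) ` PL 0 0)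
   \<and> (\<forall>a b. \<exists>m::int. (of_int m :: rat) = 1 / 2 * of_int (a + b - (a - b)\<^sup>2)
                     \<and> (a, b) \<in> PL m m)"
proof (intro conjI allI)
  show "partition_on (UNIV :: (int \<times> int) set) {PL a b | a b. True}"
    by (rule partition_on_PL)
  show "\<exists>m. (m, m) \<in> PL a b \<and> (\<forall>(x, y) \<in> PL a b. m \<le> min x y)" for a b
  proof (intro exI conjI)
    show "(vertex a b, vertex a b) \<in> PL a b"
      by (simp add: mem_PL_iff)
    show "\<forall>(x, y) \<in> PL a b. vertex a b \<le> min x y"
      using vertex_le by blast
  qed
  show "\<forall>p \<in> PL 0 0. p \<noteq> (0, 0) \<longrightarrow>
        (\<exists>k::nat. p = (int (triangle k), int (triangle (k + 1))) \<or>
                  p = (int (triangle (k + 1)), int (triangle k)))"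
    using PL_origin_triangle by blast
  show "\<forall>(x, y) \<in> PL 0 0. x + y = (x - y)\<^sup>2"
  proof clarify
    fix x y
    assume "(x, y) \<in> PL 0 0"
    then show "x + y = (x - y)\<^sup>2"
      using two_vertex[of x y] by (simp add: mem_PL_iff)
  qed
  show "\<exists>h::int. PL a b = (\<lambda>(x, y). (x + h, y + h)) ` PL 0 0" for a b
    using PL_translate by blast
  show "\<exists>m::int. (of_int m :: rat) = 1 / 2 * of_int (a + b - (a - b)\<^sup>2) \<and> (a, b) \<in> PL m m" for a b
  proof (intro exI conjI)
    show "(of_int (vertex a b) :: rat) = 1 / 2 * of_int (a + b - (a - b)\<^sup>2)"
      unfolding two_vertex[symmetric] by simp
    show "(a, b) \<in> PL (vertex a b) (vertex a b)"
      by (simp add: mem_PL_iff)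
  qed
qed

end
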